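(* Let $v\ge1$ and $q\ge 0$ be integers. If a design $\mathcal D$ with $v$ pools on $n$ objects satisfies $\hat{\mathcal D}\in\mathcal S^v_{1,q}$, then $$n\le \frac{1}{K_q}\binom{v}{\lfloor v/2\rfloor},$$ where $K_0=1$; for $q$ even, $$K_q=\sum_{s=0}^{q/2}\binom{\lfloor v/2\rfloor}{s}\binom{\lceil v/2\rceil}{s};$$ and for $q$ odd, $$K_q=K_{q-1}+\frac1T\binom{\lfloor v/2\rfloor}{(q+1)/2}\binom{\lceil v/2\rceil}{(q+1)/2},\qquad T=\left\lfloor \frac{2\lfloor v/2\rfloor}{q+1}\right\rfloor .$$
   Context: A design with $v$ pools on $n$ objects is a list $\mathcal D=(A_1,\dots,A_v)$ of subsets of $\{1,\dots,n\}$. Its dual is $\hat{\mathcal D}=(B_1,\dots,B_n)$ where $B_i=\{j\in\{1,\dots,v\}: i\in A_j\}$; $n$ is the number of members of $\hat{\mathcal D}$. For $A\subseteq\{1,\dots,n\}$ let $\phi(A)=\bigcup_{i\in A}B_i$ ($\phi(\emptyset)=\emptyset$). For integers $p,q\ge0$, $\mathcal D$ is a $(p,q)$-solution if $|\phi(A)\triangle\phi(A')|>q$ for all $A,A'\subseteq\{1,\dots,n\}$ with $A\ne A'$ and $|A|\le p$ ($\triangle$ = symmetric difference). $\mathcal S^v_{p,q}$ is the set of duals of $(p,q)$-solutions with $v$ pools, i.e. the families $(B_1,\dots,B_n)$ of subsets of $\{1,\dots,v\}$ satisfying this condition. *)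

theory Defs
  imports Complex_Main
begin

text \<open>A design on the objects \<open>1, \<dots>, n\<close> is a list of pools; pool \<open>A\<^sub>j\<close> is entry \<open>D ! (j - 1)\<close>, and likewise
  member \<open>B\<^sub>i\<close> of the dual is entry \<open>B ! (i - 1)\<close>. Since the list of pools does not determine \<open>n\<close>,
  the number of objects is a separate argument.\<close>

definition design :: "nat \<Rightarrow> nat \<Rightarrow> nat set list \<Rightarrow> bool" where
  "design v n D \<longleftrightarrow> length D = v \<and> (\<forall>A\<in>set D. A \<subseteq> {1..n})"

definition dual :: "nat \<Rightarrow> nat set list \<Rightarrow> nat set list" where
  "dual n D = map (\<lambda>i. {j \<in> {1..length D}. i \<in> D ! (j - 1)}) [1..<Suc n]"

definition positive_pools :: "nat set list \<Rightarrow> nat set \<Rightarrow> nat set" where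
  "positive_pools B A = (\<Union>i\<in>A. B ! (i - 1))"

definition pq_solution :: "nat \<Rightarrow> nat \<Rightarrow> nat \<Rightarrow> nat set list \<Rightarrow> bool" where
  "pq_solution p q n D \<longleftrightarrow>
     (\<forall>A A'. A \<subseteq> {1..n} \<longrightarrow> A' \<subseteq> {1..n} \<longrightarrow> A \<noteq> A' \<longrightarrow> card A \<le> p \<longrightarrow>
        card (sym_diff (positive_pools (dual n D) A) (positive_pools (dual n D) A')) > q)"

definition dual_solutions :: "nat \<Rightarrow> nat \<Rightarrow> nat \<Rightarrow> nat set list set" where
  "dual_solutions v p q = {dual n D |n D. design v n D \<and> pq_solution p q n D}"

text \<open>\<open>v div 2\<close> and \<open>(v + 1) div 2\<close> are the floor and the ceiling of \<open>v/2\<close>.\<close>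

definition T :: "nat \<Rightarrow> nat \<Rightarrow> nat" where
  "T v q = (2 * (v div 2)) div (q + 1)"

text \<open>For odd \<open>q\<close>, \<open>T v q = 0\<close> holds exactly when \<open>v div 2 < (q + 1) div 2\<close>; the first binomial
  coefficient of the correction term then vanishes, and the term is read as \<open>0\<close>.\<close>

definition K :: "nat \<Rightarrow> nat \<Rightarrow> real" where
  "K v q =
    (if even q
     then \<Sum>s = 0..q div 2. real ((v div 2) choose s) * real (((v + 1) div 2) choose s)
     else (\<Sum>s = 0..(q - 1) div 2. real ((v div 2) choose s) * real (((v + 1) div 2) choose s))
        + 1 / real (T v q) * real ((v div 2) choose ((q + 1) div 2))
            * real (((v + 1) div 2) choose ((q + 1) div 2)))"

lemma K_0: "K v 0 = 1"
  by (simp add: K_def)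

lemma K_odd:
  assumes "odd q"
  shows "K v q = K v (q - 1) + 1 / real (T v q) * real ((v div 2) choose ((q + 1) div 2))
            * real (((v + 1) div 2) choose ((q + 1) div 2))"
  using assms by (simp add: K_def)

end

theory Submission imports Defs begin

text \<open>Comparing \<open>{j}\<close> with \<open>{i, j}\<close> shows that the members of the dual satisfy \<open>|B\<^sub>i - B\<^sub>j| > q\<close>
  for \<open>i \<noteq> j\<close>. Put \<open>r = \<lfloor>q/2\<rfloor>\<close>. Around each \<open>B\<^sub>i\<close> take the sets \<open>X\<close> with \<open>|X| = |B\<^sub>i|\<close>: those with
  \<open>|X - B\<^sub>i| \<le> r\<close> get weight \<open>1\<close> and, for odd \<open>q\<close>, those with \<open>|X - B\<^sub>i| = r + 1\<close> get weight \<open>1/T\<close>. Along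
  any chain the total weight is at most \<open>1\<close>: a set of weight \<open>1\<close> excludes all others, and the sets on
  the outer spheres number at most \<open>T\<close> by a packing argument. The LYM inequality, in its weighted form,
  therefore bounds the sum over \<open>i\<close> of the relative size (within its layer) of the weighted ball around
  \<open>B\<^sub>i\<close>. For \<open>|B\<^sub>i| = k\<close> this relative size is a convex combination of values of the distribution
  function of the hypergeometric variable \<open>|X - B\<^sub>i|\<close>, \<open>X\<close> a random \<open>k\<close>-set, and these are smallest
  at \<open>k = \<lfloor>v/2\<rfloor>\<close>.\<close>

section \<open>Monotonicity of the hypergeometric distribution function\<close>

text \<open>With \<open>v = a + b + 1\<close> this compares the distribution functions at
  \<open>k = a\<close> and \<open>k = a + 1\<close>: over a common denominator the difference of
  their numerators telescopes to one product, nonnegative for \<open>a \<le> b\<close>.\<close>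

lemma telescoping_binomial_products:
  fixes a b m :: nat
  shows "(\<Sum>s\<le>m. (real b + 1) * real (a choose s) * real (Suc b choose s)
                 - (real a + 1) * real (Suc a choose s) * real (b choose s))
         = (real b - real a) * real (a choose m) * real (b choose m)"
proof (induction m)
  case 0
  show ?case by simp
next
  case (Suc s)
  define x x' y y' where "x = real (a choose s)" and "x' = real (a choose Suc s)"
    and "y = real (b choose s)" and "y' = real (b choose Suc s)"
  have absorb: "(real s + 1) * real (c choose Suc s) = (real c - real s) * real (c choose s)"
    for c :: nat
  proof (cases "s \<le> c")
    case True
    have "Suc s * (c choose Suc s) = (c - s) * (c choose s)"
      by (metis binomial_absorb_comp binomial_absorption)
    then show ?thesis
      using True by (metis of_nat_Suc of_nat_diff of_nat_mult add.commute)
  qed (simp add: binomial_eq_0)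
  have x: "(real s + 1) * x' = (real a - real s) * x" and y: "(real s + 1) * y' = (real b - real s) * y"
    unfolding x_def x'_def y_def y'_def by (rule absorb)+
  have "(real s + 1) * ((real b + 1) * x' * y - (real a + 1) * x * y')
      = (real b + 1) * ((real s + 1) * x') * y - (real a + 1) * x * ((real s + 1) * y')"
    by algebra
  also have "\<dots> = (real s + 1) * ((real a - real b) * x * y)"
    unfolding x y by algebra
  finally have "(real b + 1) * x' * y - (real a + 1) * x * y' = (real a - real b) * x * y"
    by simp
  \<comment> \<open>By Pascal's rule \<open>x + x'\<close> and \<open>y + y'\<close> are
    \<open>Suc a choose Suc s\<close> and \<open>Suc b choose Suc s\<close>, so the bracket is the
    next summand.\<close>
  then have "(real b - real a) * x * y + ((real b + 1) * x' * (y + y') - (real a + 1) * (x + x') * y')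
      = (real b - real a) * x' * y'"
    by algebra
  then show ?case
    using Suc by (simp add: x_def x'_def y_def y'_def)
qed

text \<open>For \<open>k \<le> v\<close> and a fixed \<open>k\<close>-subset of a
  \<open>v\<close>-set, this is the probability that a random \<open>k\<close>-subset has at most
  \<open>m\<close> elements outside it; \<open>s\<close> counts the exchanged elements.\<close>

definition hypergeom_cdf :: "nat \<Rightarrow> nat \<Rightarrow> nat \<Rightarrow> real" where
  "hypergeom_cdf v m k =
     (\<Sum>s\<le>m. real (k choose s) * real ((v - k) choose s)) / real (v choose k)"

text \<open>The absorption identity \<open>C\<close> brings both fractions to one denominator; the
  telescoped difference of the numerators has the factor \<open>b - k\<close>, nonnegative since
  \<open>2 * k < v\<close>.\<close>

lemma hypergeom_cdf_Suc_le:
  assumes "2 * k < v"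
  shows "hypergeom_cdf v m (Suc k) \<le> hypergeom_cdf v m k"
proof -
  define b where "b = v - Suc k"
  have v: "v = Suc (k + b)" and "k \<le> b"
    using assms by (auto simp: b_def)
  define L where "L = (\<Sum>s\<le>m. real (k choose s) * real (Suc b choose s))"
  define R where "R = (\<Sum>s\<le>m. real (Suc k choose s) * real (b choose s))"
  have "(real b + 1) * L - (real k + 1) * R = (real b - real k) * real (k choose m) * real (b choose m)"
    unfolding telescoping_binomial_products[symmetric] L_def R_def sum_distrib_left sum_subtractf
    by (simp add: mult.assoc)
  also have "\<dots> \<ge> 0"
    using \<open>k \<le> b\<close> by simp
  finally have le: "(real k + 1) * R \<le> (real b + 1) * L"
    by simp
  have "Suc k * (v choose Suc k) = Suc b * (v choose k)"
    unfolding v by (metis add_Suc_right binomial_absorb_comp binomial_absorption diff_add_inverse)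
  then have C: "(real k + 1) * real (v choose Suc k) = (real b + 1) * real (v choose k)"
    by (metis of_nat_Suc of_nat_mult add.commute)
  have pos: "real (v choose Suc k) > 0" "real (v choose k) > 0"
    by (simp_all add: v del: binomial_Suc_Suc)
  have "R / real (v choose Suc k) = ((real k + 1) * R) / ((real k + 1) * real (v choose Suc k))"
    by simp
  also have "\<dots> \<le> ((real b + 1) * L) / ((real b + 1) * real (v choose k))"
    unfolding C using le pos by (intro divide_right_mono) auto
  also have "\<dots> = L / real (v choose k)"
    by simp
  finally show ?thesis
    by (simp add: hypergeom_cdf_def L_def R_def v)
qed

text \<open>Up to the middle the values do not increase; above it, \<open>k\<close> and
  \<open>v - k\<close> give the same value.\<close>

lemma hypergeom_cdf_middle_le:
  assumes "k \<le> v"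
  shows "hypergeom_cdf v m (v div 2) \<le> hypergeom_cdf v m k"
proof -
  have low: "hypergeom_cdf v m (v div 2) \<le> hypergeom_cdf v m j" if "j \<le> v div 2" for j
    using that
  proof (induction j rule: inc_induct)
    case (step j)
    then show ?case
      using hypergeom_cdf_Suc_le[of j v m] by linarith
  qed simp
  show ?thesis
  proof (cases "k \<le> v div 2")
    case False
    have "hypergeom_cdf v m k = hypergeom_cdf v m (v - k)"
      using assms by (simp add: hypergeom_cdf_def binomial_symmetric[OF assms] mult.commute)
    then show ?thesis
      using low[of "v - k"] False by simp
  qed (rule low)
qed

section \<open>Weighted LYM inequality\<close>

text \<open>Induction on \<open>U\<close>: average the bound for \<open>U - {x}\<close>, whose chains extend by \<open>U\<close>, over all \<open>x \<in> U\<close>.\<close>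

lemma weighted_LYM:
  fixes w :: "'a set \<Rightarrow> real"
  assumes "finite U"
    and "\<And>\<C>. \<C> \<subseteq> Pow U \<Longrightarrow> (\<And>X Y. X \<in> \<C> \<Longrightarrow> Y \<in> \<C> \<Longrightarrow> X \<subseteq> Y \<or> Y \<subseteq> X) \<Longrightarrow> (\<Sum>X\<in>\<C>. w X) \<le> c"
  shows "(\<Sum>X\<in>Pow U. w X / real (card U choose card X)) \<le> c"
  using assms
\<comment> \<open>The bound varies as well: for \<open>U - {x}\<close> it drops to
  \<open>c - w U\<close>.\<close>
proof (induction "card U" arbitrary: U c)
  case 0
  then show ?case
    using "0.prems"(2)[of "{{}}"] by simp
next
  case (Suc u)
  have U: "U \<noteq> {}" "card U = Suc u"
    using Suc by auto
  have IH: "(\<Sum>X\<in>Pow (U - {x}). w X / real (u choose card X)) \<le> c - w U" if x: "x \<in> U" for x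
  proof -
    have u: "u = card (U - {x})"
      using U x Suc.prems by simp
    show ?thesis
      unfolding u
    proof (rule Suc.hyps(1)[OF u])
      show "finite (U - {x})"
        using Suc.prems by simp
      fix \<C> assume \<C>: "\<C> \<subseteq> Pow (U - {x})" "\<And>X Y. X \<in> \<C> \<Longrightarrow> Y \<in> \<C> \<Longrightarrow> X \<subseteq> Y \<or> Y \<subseteq> X"
      have "finite \<C>" "U \<notin> \<C>"
        using \<C>(1) x Suc.prems(1) by (auto intro: finite_subset)
      moreover have "(\<Sum>X\<in>insert U \<C>. w X) \<le> c"
        using \<C> by (intro Suc.prems(2)) auto
      ultimately show "(\<Sum>X\<in>\<C>. w X) \<le> c - w U"
        by simp
    qed
  qed
  define h where "h X = w X / real (u choose card X)" for X
  \<comment> \<open>A proper subset \<open>X\<close> survives the deletion of exactly the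
    \<open>Suc u - card X\<close> points outside it; absorption turns this multiplicity into the
    change of denominator from \<open>u\<close> to \<open>Suc u\<close>.\<close>
  have inner: "(\<Sum>x\<in>U. if X \<subseteq> U - {x} then h X else 0) = real (Suc u) * (w X / real (Suc u choose card X))"
    if X: "X \<in> Pow U - {U}" for X
  proof -
    have cX: "card X \<le> u"
    proof -
      have "X \<subset> U"
        using X by auto
      then show ?thesis
        using psubset_card_mono[OF Suc.prems(1), of X] U(2) by simp
    qed
    have "{x\<in>U. X \<subseteq> U - {x}} = U - X"
      using X by auto
    moreover have "card (U - X) = Suc u - card X"
      using X U Suc.prems(1) by (auto simp: card_Diff_subset finite_subset)
    ultimately have count: "(\<Sum>x\<in>U. if X \<subseteq> U - {x} then h X else 0) = real (Suc u - card X) * h X"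
      using Suc.prems(1) by (simp add: sum.If_cases Int_def)
    have absorb: "real (Suc u - card X) * real (Suc u choose card X) = real (Suc u) * real (u choose card X)"
      using binomial_absorb_comp[of "Suc u" "card X"] by (metis diff_Suc_1 of_nat_mult)
    have pos: "real (u choose card X) > 0" "real (Suc u choose card X) > 0"
      using cX by auto
    have "a * (y / b) = a' * (y / b')" if "a * b' = a' * b" "b > 0" "b' > 0" for a a' b b' y :: real
      using that by (simp add: frac_eq_eq algebra_simps)
    from this[OF absorb pos] show ?thesis
      unfolding count unfolding h_def .
  qed
  have "(\<Sum>x\<in>U. \<Sum>X\<in>Pow (U - {x}). h X) \<le> (\<Sum>x\<in>U. c - w U)"
    unfolding h_def by (intro sum_mono IH)
  also have "(\<Sum>x\<in>U. \<Sum>X\<in>Pow (U - {x}). h X)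
      = (\<Sum>x\<in>U. \<Sum>X\<in>Pow U - {U}. if X \<subseteq> U - {x} then h X else 0)"
    using Suc.prems(1) by (intro sum.cong refl sum.mono_neutral_cong_left) auto
  also have "\<dots> = (\<Sum>X\<in>Pow U - {U}. real (Suc u) * (w X / real (Suc u choose card X)))"
    by (subst sum.swap) (intro sum.cong refl inner)
  also have "\<dots> = real (Suc u) * (\<Sum>X\<in>Pow U - {U}. w X / real (Suc u choose card X))"
    by (rule sum_distrib_left[symmetric])
  finally have "(\<Sum>X\<in>Pow U - {U}. w X / real (Suc u choose card X)) \<le> c - w U"
    using U by (simp del: of_nat_Suc binomial_Suc_Suc)
  \<comment> \<open>The remaining set \<open>U\<close> has denominator 1 and gives back
    \<open>w U\<close>.\<close>
  then show ?case
    using Suc.prems(1) U by (subst sum.remove[of _ U]) (auto simp del: binomial_Suc_Suc)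
qed

section \<open>Counting sets at a given distance within a layer\<close>

lemma card_Diff_eq_card_Diff:
  assumes "finite X" "finite B" "card X = card B"
  shows "card (X - B) = card (B - X)"
  using assms by (simp add: card_Diff_subset_Int Int_commute)

text \<open>\<open>X\<close> corresponds to the pair of the elements of \<open>B\<close> that it
  loses and the elements of \<open>U - B\<close> that it gains; equal sizes make both numbers
  \<open>s\<close>.\<close>

lemma card_sets_at_distance:
  assumes "finite U" "B \<subseteq> U"
  shows "card {X. X \<subseteq> U \<and> card X = card B \<and> card (X - B) = s}
         = (card B choose s) * ((card U - card B) choose s)"
proof -
  have fin: "finite B" "finite (U - B)"
    using assms by (auto intro: finite_subset)
  have "bij_betw (\<lambda>X. (B - X, X - B)) {X. X \<subseteq> U \<and> card X = card B \<and> card (X - B) = s}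
      ({W. W \<subseteq> B \<and> card W = s} \<times> {Z. Z \<subseteq> U - B \<and> card Z = s})"
  proof (rule bij_betw_byWitness[where f' = "\<lambda>(W, Z). (B - W) \<union> Z"])
    have "card (B - X) = card (X - B)" if "X \<subseteq> U" "card X = card B" for X
      using that assms by (intro card_Diff_eq_card_Diff) (auto intro: finite_subset)
    then show "(\<lambda>X. (B - X, X - B)) ` {X. X \<subseteq> U \<and> card X = card B \<and> card (X - B) = s}
      \<subseteq> {W. W \<subseteq> B \<and> card W = s} \<times> {Z. Z \<subseteq> U - B \<and> card Z = s}"
      by auto
    have "card ((B - W) \<union> Z) = card B \<and> ((B - W) \<union> Z) - B = Z"
      if "W \<subseteq> B" "card W = s" "Z \<subseteq> U - B" "card Z = s" for W Z
    proof
      have "finite W" "finite Z"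
        using that fin by (auto intro: finite_subset)
      moreover have "card W \<le> card B"
        using that fin by (intro card_mono)
      moreover have "(B - W) \<inter> Z = {}"
        using that by auto
      ultimately show "card ((B - W) \<union> Z) = card B"
        using that fin by (simp add: card_Un_disjoint card_Diff_subset)
    qed (use that in auto)
    then show "(\<lambda>(W, Z). B - W \<union> Z) ` ({W. W \<subseteq> B \<and> card W = s} \<times> {Z. Z \<subseteq> U - B \<and> card Z = s})
      \<subseteq> {X. X \<subseteq> U \<and> card X = card B \<and> card (X - B) = s}"
      using assms by auto
  qed auto
  then have "card {X. X \<subseteq> U \<and> card X = card B \<and> card (X - B) = s}
      = card {W. W \<subseteq> B \<and> card W = s} * card {Z. Z \<subseteq> U - B \<and> card Z = s}"
    by (simp add: bij_betw_same_card card_cartesian_product)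
  then show ?thesis
    using assms fin by (simp add: n_subsets card_Diff_subset)
qed

lemma sum_over_distances:
  fixes f :: "nat \<Rightarrow> real"
  assumes "finite U" "B \<subseteq> U" "\<And>s. s > m \<Longrightarrow> f s = 0"
  shows "(\<Sum>X\<in>Pow U. if card X = card B then f (card (X - B)) else 0)
         = (\<Sum>s\<le>m. f s * (real (card B choose s) * real ((card U - card B) choose s)))"
proof -
  define S where "S = {X \<in> Pow U. card X = card B \<and> card (X - B) \<le> m}"
  have "finite S"
    using assms(1) by (simp add: S_def)
  have "(\<Sum>X\<in>Pow U. if card X = card B then f (card (X - B)) else 0) = (\<Sum>X\<in>S. f (card (X - B)))"
    using assms(1,3) by (intro sum.mono_neutral_cong_right) (auto simp: S_def not_le)
  also have "\<dots> = (\<Sum>s\<le>m. \<Sum>X | X \<in> S \<and> card (X - B) = s. f (card (X - B)))"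
    using \<open>finite S\<close> by (intro sum.group[symmetric]) (auto simp: S_def)
  also have "\<dots> = (\<Sum>s\<le>m. f s * real (card {X. X \<subseteq> U \<and> card X = card B \<and> card (X - B) = s}))"
  proof (rule sum.cong[OF refl])
    fix s assume "s \<in> {..m}"
    then have "{X. X \<in> S \<and> card (X - B) = s} = {X. X \<subseteq> U \<and> card X = card B \<and> card (X - B) = s}"
      by (auto simp: S_def)
    moreover have "(\<Sum>X | X \<in> S \<and> card (X - B) = s. f (card (X - B)))
        = (\<Sum>X | X \<in> S \<and> card (X - B) = s. f s)"
      by (intro sum.cong) auto
    ultimately show "(\<Sum>X | X \<in> S \<and> card (X - B) = s. f (card (X - B)))
        = f s * real (card {X. X \<subseteq> U \<and> card X = card B \<and> card (X - B) = s})"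
      by simp
  qed
  finally show ?thesis
    using assms by (simp add: card_sets_at_distance)
qed

section \<open>Sphere packing along a chain\<close>

text \<open>A triangle inequality: an element of \<open>B - B'\<close> is missing from
  \<open>X\<close> or lies in \<open>Y - B'\<close>.\<close>

lemma card_Diff_le_via_subset:
  assumes "finite B" "finite Y" "X \<subseteq> Y"
  shows "card (B - B') \<le> card (B - X) + card (Y - B')"
proof -
  have "card (B - B') \<le> card ((B - X) \<union> (Y - B'))"
    using assms by (intro card_mono) auto
  also have "\<dots> \<le> card (B - X) + card (Y - B')"
    by (rule card_Un_le)
  finally show ?thesis .
qed

text \<open>Equality in the preceding bound forces the two covering sets to be disjoint and to fill
  \<open>B - B'\<close> exactly.\<close>

lemma card_Diff_eq_via_subset:
  assumes "finite B" "finite Y" "X \<subseteq> Y"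
    and "card (B - X) + card (Y - B') \<le> card (B - B')"
  shows "B - X \<subseteq> B - B'" "Y - B' \<subseteq> B \<inter> X"
proof -
  have sub: "B - B' \<subseteq> (B - X) \<union> (Y - B')"
    using assms(3) by auto
  have fin: "finite (B - X)" "finite (Y - B')"
    using assms by auto
  have sum: "card (B - X) + card (Y - B') = card ((B - X) \<union> (Y - B')) + card ((B - X) \<inter> (Y - B'))"
    using card_Un_Int[OF fin] .
  have eq: "B - B' = (B - X) \<union> (Y - B')"
    using sub fin sum assms(4) by (intro card_seteq) auto
  then have "card ((B - X) \<inter> (Y - B')) = 0"
    using sum assms(4) by simp
  then have "(B - X) \<inter> (Y - B') = {}"
    using fin by simp
  then show "B - X \<subseteq> B - B'" "Y - B' \<subseteq> B \<inter> X"
    using eq by auto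
qed

text \<open>The sets \<open>X p - C p\<close> are disjoint and all lie inside the smallest \<open>X p\<close>, while the sets \<open>C p - X p\<close>
  are disjoint and all lie outside it.\<close>

lemma sphere_packing_along_chain:
  fixes X C :: "'p \<Rightarrow> 'a set"
  assumes "finite P" "finite U"
    and sub: "\<And>p. p \<in> P \<Longrightarrow> X p \<subseteq> U" "\<And>p. p \<in> P \<Longrightarrow> C p \<subseteq> U"
    and dist: "\<And>p. p \<in> P \<Longrightarrow> card (X p - C p) = t" "\<And>p. p \<in> P \<Longrightarrow> card (C p - X p) = t"
    and chain: "\<And>p p'. p \<in> P \<Longrightarrow> p' \<in> P \<Longrightarrow> X p \<subseteq> X p' \<or> X p' \<subseteq> X p"
    and sep: "\<And>p p'. p \<in> P \<Longrightarrow> p' \<in> P \<Longrightarrow> p \<noteq> p' \<Longrightarrow> 2 * t \<le> card (C p - C p')"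
  shows "card P * t \<le> card U div 2"
proof (cases "P = {}")
  case False
  have fin: "finite (X p)" "finite (C p)" if "p \<in> P" for p
    using finite_subset[OF sub(1)[OF that] assms(2)] finite_subset[OF sub(2)[OF that] assms(2)] .
  obtain p0 where p0: "p0 \<in> P" and least: "\<And>p. p \<in> P \<Longrightarrow> card (X p0) \<le> card (X p)"
    using ex_min_if_finite[of "(card \<circ> X) ` P"] False assms(1) by (force simp: not_less)
  have bottom: "X p0 \<subseteq> X p" if "p \<in> P" for p
    using chain[OF p0 that] least[OF that] card_seteq[OF fin(1)[OF p0], of "X p"] by auto
  \<comment> \<open>The two distances add up to \<open>2 * t\<close>, at most
    \<open>card (C p - C p')\<close> by \<open>sep\<close>, so the equality case applies.\<close>
  have ordered: "C p - X p \<subseteq> C p - C p'" "X p' - C p' \<subseteq> C p \<inter> X p"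
    if "p \<in> P" "p' \<in> P" "p \<noteq> p'" "X p \<subseteq> X p'" for p p'
    using card_Diff_eq_via_subset[of "C p" "X p'" "X p" "C p'"] that fin dist sep[of p p'] by auto
  have disj: "(X p - C p) \<inter> (X p' - C p') = {} \<and> (C p - X p) \<inter> (C p' - X p') = {}"
    if "p \<in> P" "p' \<in> P" "p \<noteq> p'" for p p'
    using chain[OF that(1,2)]
  proof
    assume "X p \<subseteq> X p'"
    from ordered[OF that this] show ?thesis by blast
  next
    assume "X p' \<subseteq> X p"
    from ordered[OF that(2,1) that(3)[symmetric] this] show ?thesis by blast
  qed
  have "card P * t = card (\<Union>p\<in>P. X p - C p)"
    using disj fin dist assms(1) by (subst card_UN_disjoint) auto
  \<comment> \<open>For \<open>p \<noteq> p0\<close>, \<open>ordered\<close> places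
    \<open>X p - C p\<close> inside \<open>C p0 \<inter> X p0\<close>.\<close>
  also have "\<dots> \<le> card (X p0)"
  proof (rule card_mono[OF fin(1)[OF p0]], rule UN_least)
    fix p assume "p \<in> P"
    then show "X p - C p \<subseteq> X p0"
      using ordered(2)[OF p0, of p] bottom by (cases "p = p0") auto
  qed
  finally have inner: "card P * t \<le> card (X p0)" .
  have "card P * t = card (\<Union>p\<in>P. C p - X p)"
    using disj fin dist assms(1) by (subst card_UN_disjoint) auto
  also have "\<dots> \<le> card (U - X p0)"
    using bottom sub assms(2) by (intro card_mono) fastforce+
  also have "\<dots> = card U - card (X p0)"
    using p0 sub fin by (intro card_Diff_subset)
  \<comment> \<open>Adding the bounds \<open>card (X p0)\<close> and
    \<open>card U - card (X p0)\<close> gives \<open>2 * (card P * t) \<le> card U\<close>.\<close>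
  finally show ?thesis
    using inner by linarith
qed simp

section \<open>Weights along chains and the size of separated families\<close>

text \<open>One profile serves both parities: \<open>c\<close> will be \<open>0\<close> for even
  \<open>q\<close> and \<open>1 / T v q\<close> for odd \<open>q\<close>.\<close>

definition ball_weight :: "nat \<Rightarrow> real \<Rightarrow> nat \<Rightarrow> real" where
  "ball_weight r c s = (if s \<le> r then 1 else if s = Suc r then c else 0)"

text \<open>The sum runs over pairs of a chain member and a centre in its layer. Two distinct pairs
  of nonzero weight have distances adding up to more than \<open>q\<close>. So either one pair of
  weight 1 stands alone, or all pairs have distance \<open>Suc r\<close> and packing bounds their
  number.\<close>

lemma chain_weight_le_1:
  fixes B :: "'i \<Rightarrow> 'a set"
  assumes "finite U" "finite I" and B: "\<And>i. i \<in> I \<Longrightarrow> B i \<subseteq> U"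
    and sep: "\<And>i j. i \<in> I \<Longrightarrow> j \<in> I \<Longrightarrow> i \<noteq> j \<Longrightarrow> q < card (B i - B j)"
    and q: "2 * r \<le> q" "c \<noteq> 0 \<Longrightarrow> 2 * r < q"
    and c: "\<And>m. m * Suc r \<le> card U div 2 \<Longrightarrow> c * real m \<le> 1"
    and chain: "\<C> \<subseteq> Pow U" "\<And>X Y. X \<in> \<C> \<Longrightarrow> Y \<in> \<C> \<Longrightarrow> X \<subseteq> Y \<or> Y \<subseteq> X"
  shows "(\<Sum>X\<in>\<C>. \<Sum>i\<in>I. if card X = card (B i) then ball_weight r c (card (X - B i)) else 0) \<le> 1"
proof -
  define d where "d p = card (fst p - B (snd p))" for p
  define P where "P = {p \<in> \<C> \<times> I. card (fst p) = card (B (snd p)) \<and> ball_weight r c (d p) \<noteq> 0}"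
  have "finite \<C>"
    using chain(1) assms(1) by (meson finite_Pow_iff finite_subset)
  then have "finite P"
    using assms(2) by (simp add: P_def)
  have subsets: "fst p \<subseteq> U" "B (snd p) \<subseteq> U" if "p \<in> P" for p
  proof -
    have "fst p \<in> \<C>" "snd p \<in> I"
      using that by (auto simp: P_def)
    then show "fst p \<subseteq> U" "B (snd p) \<subseteq> U"
      using B chain(1) by blast+
  qed
  then have fin: "finite (fst p)" "finite (B (snd p))" if "p \<in> P" for p
    using finite_subset[OF _ assms(1)] that by simp_all
  have d': "card (B (snd p) - fst p) = d p" if "p \<in> P" for p
    using that fin[OF that] by (simp add: P_def d_def card_Diff_eq_card_Diff)
  have comparable: "fst p \<subseteq> fst p' \<or> fst p' \<subseteq> fst p" if "p \<in> P" "p' \<in> P" for p p'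
    using that by (intro chain(2)) (auto simp: P_def)
  \<comment> \<open>A common centre means a common layer, where comparable sets coincide.\<close>
  have snd_neq: "snd p \<noteq> snd p'" if "p \<in> P" "p' \<in> P" "p \<noteq> p'" for p p'
  proof
    assume eq: "snd p = snd p'"
    then have "card (fst p) = card (fst p')"
      using that by (simp add: P_def)
    then have "fst p = fst p'"
      using comparable[OF that(1,2)] fin that by (metis card_subset_eq)
    then show False
      using eq that(3) by (simp add: prod_eq_iff)
  qed
  have sepP: "q < card (B (snd p) - B (snd p'))" if "p \<in> P" "p' \<in> P" "p \<noteq> p'" for p p'
    using snd_neq[OF that] that by (auto simp: P_def intro: sep)
  have far: "q < d p + d p'" if "p \<in> P" "p' \<in> P" "p \<noteq> p'" for p p'
    using comparable[OF that(1,2)]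
  proof
    assume "fst p \<subseteq> fst p'"
    then have "card (B (snd p) - B (snd p')) \<le> d p + d p'"
      using card_Diff_le_via_subset[of "B (snd p)" "fst p'" "fst p" "B (snd p')"] fin that d'
      by (simp add: d_def)
    then show ?thesis
      using sepP[OF that] by linarith
  next
    assume "fst p' \<subseteq> fst p"
    then have "card (B (snd p') - B (snd p)) \<le> d p' + d p"
      using card_Diff_le_via_subset[of "B (snd p')" "fst p" "fst p'" "B (snd p)"] fin that d'
      by (simp add: d_def)
    then show ?thesis
      using sepP[OF that(2,1)] that(3) by auto
  qed
  have "(\<Sum>X\<in>\<C>. \<Sum>i\<in>I. if card X = card (B i) then ball_weight r c (card (X - B i)) else 0)
      = (\<Sum>p\<in>\<C> \<times> I. if card (fst p) = card (B (snd p)) then ball_weight r c (d p) else 0)"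
    unfolding d_def by (simp add: sum.cartesian_product case_prod_beta)
  also have "\<dots> = (\<Sum>p\<in>P. ball_weight r c (d p))"
    using \<open>finite \<C>\<close> assms(2) by (intro sum.mono_neutral_cong_right) (auto simp: P_def)
  also have "\<dots> \<le> 1"
  proof (cases "\<exists>p\<in>P. d p \<le> r")
    case True
    then obtain p where p: "p \<in> P" "d p \<le> r" by blast
    \<comment> \<open>Otherwise the distances would add up to at most \<open>2 * r\<close>, or to at
      most \<open>2 * r + 1\<close> with \<open>c \<noteq> 0\<close>; in both cases to at most
      \<open>q\<close>.\<close>
    have "p' = p" if "p' \<in> P" for p'
    proof (rule ccontr)
      assume "p' \<noteq> p"
      then have "q < d p + d p'"
        using far p(1) that by blast
      moreover have "d p' \<le> r \<or> d p' = Suc r \<and> c \<noteq> 0"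
        using that by (auto simp: P_def ball_weight_def split: if_splits)
      ultimately show False
        using p(2) q by linarith
    qed
    then have "P = {p}"
      using p(1) by blast
    then show ?thesis
      using p by (simp add: ball_weight_def)
  next
    case False
    then have dP: "d p = Suc r" "c \<noteq> 0" if "p \<in> P" for p
    proof -
      have "\<not> d p \<le> r" "ball_weight r c (d p) \<noteq> 0"
        using that False unfolding P_def by blast+
      then show "d p = Suc r" "c \<noteq> 0"
        by (auto simp: ball_weight_def split: if_splits)
    qed
    have "card P * Suc r \<le> card U div 2"
    proof (rule sphere_packing_along_chain[where X = fst and C = "\<lambda>p. B (snd p)"])
      show "card (fst p - B (snd p)) = Suc r" "card (B (snd p) - fst p) = Suc r" if "p \<in> P" for p
        using dP(1)[OF that] d'[OF that] by (simp_all add: d_def)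
      \<comment> \<open>\<open>c \<noteq> 0\<close> gives \<open>2 * r < q\<close>, hence
        \<open>2 * Suc r \<le> q + 1\<close>, which the separation provides.\<close>
      show "2 * Suc r \<le> card (B (snd p) - B (snd p'))" if "p \<in> P" "p' \<in> P" "p \<noteq> p'" for p p'
        using sepP[OF that] q(2)[OF dP(2)[OF that(1)]] by simp
      show "fst p \<subseteq> U" "B (snd p) \<subseteq> U" if "p \<in> P" for p
        using subsets[OF that] .
    qed (use \<open>finite P\<close> assms(1) comparable in simp_all)
    then have "c * real (card P) \<le> 1"
      by (rule c)
    moreover have "(\<Sum>p\<in>P. ball_weight r c (d p)) = (\<Sum>p\<in>P. c)"
      by (rule sum.cong) (simp_all add: ball_weight_def dP(1))
    ultimately show ?thesis
      by (simp add: mult.commute)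
  qed
  finally show ?thesis .
qed

lemma card_separated_family_le:
  fixes B :: "'i \<Rightarrow> 'a set"
  assumes "finite U" "finite I" and B: "\<And>i. i \<in> I \<Longrightarrow> B i \<subseteq> U"
    and sep: "\<And>i j. i \<in> I \<Longrightarrow> j \<in> I \<Longrightarrow> i \<noteq> j \<Longrightarrow> q < card (B i - B j)"
    and q: "2 * r \<le> q" "c \<noteq> 0 \<Longrightarrow> 2 * r < q"
    and c: "\<And>m. m * Suc r \<le> card U div 2 \<Longrightarrow> c * real m \<le> 1" "0 \<le> c" "c \<le> 1"
  shows "real (card I) * ((1 - c) * hypergeom_cdf (card U) r (card U div 2)
           + c * hypergeom_cdf (card U) (Suc r) (card U div 2)) \<le> 1"
proof -
  let ?v = "card U"
  let ?h = "\<lambda>k. (1 - c) * hypergeom_cdf ?v r k + c * hypergeom_cdf ?v (Suc r) k"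
  let ?g = "\<lambda>X i. if card X = card (B i) then ball_weight r c (card (X - B i)) else 0"
  have "real (card I) * ?h (?v div 2) = (\<Sum>i\<in>I. ?h (?v div 2))"
    by simp
  \<comment> \<open>Both coefficients \<open>1 - c\<close> and \<open>c\<close> are nonnegative, so
    each distribution function may be bounded below by its middle value.\<close>
  also have "\<dots> \<le> (\<Sum>i\<in>I. ?h (card (B i)))"
    using B c(2,3) assms(1)
    by (intro sum_mono add_mono mult_left_mono hypergeom_cdf_middle_le) (auto intro: card_mono)
  also have "\<dots> = (\<Sum>i\<in>I. \<Sum>X\<in>Pow U. ?g X i / real (?v choose card X))"
  proof (rule sum.cong[OF refl])
    fix i assume i: "i \<in> I"
    let ?k = "card (B i)"
    have "(\<Sum>X\<in>Pow U. ?g X i / real (?v choose card X)) = (\<Sum>X\<in>Pow U. ?g X i) / real (?v choose ?k)"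
      unfolding sum_divide_distrib by (intro sum.cong) auto
    also have "(\<Sum>X\<in>Pow U. ?g X i)
        = (\<Sum>s\<le>Suc r. ball_weight r c s * (real (?k choose s) * real ((?v - ?k) choose s)))"
      using assms(1) B[OF i] by (intro sum_over_distances) (auto simp: ball_weight_def)
    also have "\<dots> = (\<Sum>s\<le>r. real (?k choose s) * real ((?v - ?k) choose s))
        + c * (real (?k choose Suc r) * real ((?v - ?k) choose Suc r))"
      by (simp add: ball_weight_def)
    \<comment> \<open>The sphere of radius \<open>Suc r\<close> is a difference of two balls, so
      weighting it by \<open>c\<close> mixes the balls with coefficients \<open>1 - c\<close> and
      \<open>c\<close>.\<close>
    also have "\<dots> / real (?v choose ?k) = ?h ?k"
      unfolding hypergeom_cdf_def by (simp add: algebra_simps add_divide_distrib diff_divide_distrib)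
    finally show "?h ?k = (\<Sum>X\<in>Pow U. ?g X i / real (?v choose card X))" ..
  qed
  also have "\<dots> = (\<Sum>X\<in>Pow U. (\<Sum>i\<in>I. ?g X i) / real (?v choose card X))"
    by (subst sum.swap) (simp add: sum_divide_distrib)
  also have "\<dots> \<le> 1"
    using assms(1)
  proof (rule weighted_LYM)
    fix \<C> assume "\<C> \<subseteq> Pow U" "\<And>X Y. X \<in> \<C> \<Longrightarrow> Y \<in> \<C> \<Longrightarrow> X \<subseteq> Y \<or> Y \<subseteq> X"
    with assms(1,2) B sep q c(1) show "(\<Sum>X\<in>\<C>. \<Sum>i\<in>I. ?g X i) \<le> 1"
      by (rule chain_weight_le_1)
  qed
  finally show ?thesis .
qed

section \<open>Application to designs\<close>

lemma K_pos: "K v q > 0"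
proof -
  have "(\<Sum>s = 0..r. real ((v div 2) choose s) * real (((v + 1) div 2) choose s)) \<ge> 1" for r
    using member_le_sum[of 0 "{0..r}" "\<lambda>s. real ((v div 2) choose s) * real (((v + 1) div 2) choose s)"]
    by simp
  then show ?thesis
    unfolding K_def by (smt (verit) divide_nonneg_nonneg mult_nonneg_nonneg of_nat_0_le_iff)
qed

theorem theorem1:
  fixes v q n :: nat and D :: "nat set list"
  assumes "v \<ge> 1"
    and "design v n D"
    and "dual n D \<in> dual_solutions v 1 q"
  shows "real n \<le> 1 / K v q * real (v choose (v div 2))"
proof -
  obtain n' D' where D': "dual n D = dual n' D'" "design v n' D'" "pq_solution 1 q n' D'"
    using assms(3) unfolding dual_solutions_def by blast
  \<comment> \<open>The dual has one member per object, so its length determines the number of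
    objects.\<close>
  have "length (dual n D) = length (dual n' D')"
    using D'(1) by simp
  then have "n' = n"
    by (simp add: dual_def del: upt_Suc)
  define B where "B i = dual n D' ! (i - 1)" for i
  have B: "B i \<subseteq> {1..v}" if "i \<in> {1..n}" for i
    using that D'(2) unfolding B_def dual_def design_def by (auto simp del: upt_Suc)
  have sep: "q < card (B i - B j)" if "i \<in> {1..n}" "j \<in> {1..n}" "i \<noteq> j" for i j
  proof -
    have "card (sym_diff (positive_pools (dual n' D') {j}) (positive_pools (dual n' D') {i, j})) > q"
      using D'(3) that \<open>n' = n\<close> unfolding pq_solution_def
      by (elim allE[of _ "{j}"] allE[of _ "{i, j}"]) auto
    also have "sym_diff (positive_pools (dual n' D') {j}) (positive_pools (dual n' D') {i, j}) = B i - B j"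
      by (auto simp: positive_pools_def B_def \<open>n' = n\<close>)
    finally show ?thesis .
  qed
  define r where "r = (if even q then q div 2 else (q - 1) div 2)"
  \<comment> \<open>For odd \<open>q\<close> with \<open>T v q = 0\<close>, division by zero makes
    \<open>c = 0\<close>, in agreement with the correction term of \<open>K\<close>.\<close>
  define c where "c = (if even q then 0 else 1 / real (T v q))"
  have c01: "0 \<le> c" "c \<le> 1"
    by (auto simp: c_def divide_le_eq_1)
  have packing: "c * real m \<le> 1" if "m * Suc r \<le> card {1..v} div 2" for m
  proof (cases "even q")
    case False
    then obtain t where t: "q = 2 * t + 1"
      by (rule oddE)
    \<comment> \<open>Since \<open>q + 1 = 2 * Suc t\<close> and \<open>t = r\<close>,
      \<open>T v q\<close> is the largest \<open>m\<close> with
      \<open>m * Suc r \<le> v div 2\<close>.\<close>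
    have "T v q = 2 * (v div 2) div (2 * Suc t)"
      by (simp add: T_def t)
    also have "\<dots> = v div 2 div Suc t"
      by (rule div_mult_mult1) simp
    finally have "m \<le> T v q"
      using that by (simp add: r_def t less_eq_div_iff_mult_less_eq)
    then show ?thesis
      using False by (auto simp: c_def divide_le_eq_1)
  qed (simp add: c_def)
  have "real (card {1..n}) * ((1 - c) * hypergeom_cdf (card {1..v}) r (card {1..v} div 2)
      + c * hypergeom_cdf (card {1..v}) (Suc r) (card {1..v} div 2)) \<le> 1"
    using B sep packing c01
    by (intro card_separated_family_le[where B = B and q = q]) (auto simp: r_def c_def elim!: oddE)
  then have *: "real n * ((1 - c) * hypergeom_cdf v r (v div 2) + c * hypergeom_cdf v (Suc r) (v div 2)) \<le> 1"
    by simp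
  have half: "v - v div 2 = (v + 1) div 2"
    by linarith
  have r_odd: "(q + 1) div 2 = Suc r" if "odd q"
    using that by (auto simp: r_def elim!: oddE)
  \<comment> \<open>Thus \<open>K v q\<close> is the total weight of the ball around a set of size
    \<open>v div 2\<close>.\<close>
  have K: "K v q = (\<Sum>s\<le>r. real ((v div 2) choose s) * real (((v + 1) div 2) choose s))
      + c * (real ((v div 2) choose Suc r) * real (((v + 1) div 2) choose Suc r))"
    using r_odd by (auto simp: K_def r_def c_def atLeast0AtMost)
  have "(1 - c) * hypergeom_cdf v r (v div 2) + c * hypergeom_cdf v (Suc r) (v div 2)
      = K v q / real (v choose (v div 2))"
    unfolding hypergeom_cdf_def half K
    by (simp add: algebra_simps add_divide_distrib diff_divide_distrib)
  with * have "real n * (K v q / real (v choose (v div 2))) \<le> 1"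
    by simp
  moreover have "real (v choose (v div 2)) > 0"
    by simp
  ultimately show ?thesis
    using K_pos[of v q] by (simp add: field_simps)
qed

end
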